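(* Let $\mathcal L$ be a finite, atomic, graded and coatomic lattice, let $\mathcal B$ be the family of bases of $\mathcal L$ and $\mathcal B^{opp}$ the family of bases of $\mathcal L^{opp}$. For $I\in\mathcal B$ put $I^{opp}=\{\bigvee(I\setminus\{a\}) : a\in I\}$. Then $I\mapsto I^{opp}$ is a well-defined bijection $\mathcal B\to\mathcal B^{opp}$.
   Context: Graded: $\mathcal L$ has least element $\hat0$, greatest element $\hat1$ and a rank function with $\mathrm{rank}(\hat0)=0$, order-preserving, increasing by exactly $1$ along covering relations. Atoms cover $\hat0$, coatoms are covered by $\hat1$; atomic (coatomic) means every element is a join of atoms (meet of coatoms). $\mathcal L^{opp}$ is the lattice on the same set with the reverse order; it is finite, graded (with rank $\mathrm{rank}(\hat1)-\mathrm{rank}(X)$) and atomic, its atoms being the coatoms of $\mathcal L$. For a finite bounded lattice $\mathcal K$ and a linear order $\omega$ on its atoms, a nonempty set $D$ of atoms is bounded below if some atom $a$ is strictly smaller than all $d\in D$ in $\omega$ and $a\le\bigvee D$ in $\mathcal K$; a set of atoms is NBB for $\omega$ if it contains no bounded below subset; $I(\mathcal K)$ is the family of sets of atoms NBB for at least one linear order. An element $I\in I(\mathcal K)$ is geometric if $\mathrm{rank}(\bigvee I)=|I|$; a basis of $\mathcal K$ is an inclusion-maximal member of $I(\mathcal K)$ all of whose subsets are geometric. *)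

theory Defs
  imports Main "HOL-Library.Dual_Ordered_Lattice"
begin

text \<open>
  A finite lattice is a type of sort \<open>{finite, complete_lattice}\<close> (every finite nonempty
  lattice is complete), with joins and meets of arbitrary sets given by \<^const>\<open>Sup\<close> and
  \<^const>\<open>Inf\<close>; in particular the join of the empty set is \<^const>\<open>bot\<close>.
  The opposite lattice of \<open>'a\<close> is \<open>'a dual\<close>, the copy of \<open>'a\<close> with the
  reverse order.
\<close>

definition covers :: "'a::order \<Rightarrow> 'a \<Rightarrow> bool" where
  "covers y x \<longleftrightarrow> x < y \<and> \<not> (\<exists>z. x < z \<and> z < y)"

definition atoms :: "'a::complete_lattice set" where
  "atoms = {a. covers a bot}"

definition coatoms :: "'a::complete_lattice set" where
  "coatoms = {c. covers top c}"

definition atomic_lattice :: "'a::complete_lattice itself \<Rightarrow> bool" where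
  "atomic_lattice TYPE('a) \<longleftrightarrow> (\<forall>x::'a. \<exists>A \<subseteq> atoms. x = Sup A)"

definition coatomic_lattice :: "'a::complete_lattice itself \<Rightarrow> bool" where
  "coatomic_lattice TYPE('a) \<longleftrightarrow> (\<forall>x::'a. \<exists>C \<subseteq> coatoms. x = Inf C)"

definition rank_function :: "('a::complete_lattice \<Rightarrow> nat) \<Rightarrow> bool" where
  "rank_function rk \<longleftrightarrow>
     rk bot = 0 \<and> mono rk \<and> (\<forall>x y. covers y x \<longrightarrow> rk y = rk x + 1)"

definition opp_rank :: "('a::complete_lattice \<Rightarrow> nat) \<Rightarrow> 'a dual \<Rightarrow> nat" where
  "opp_rank rk X = rk top - rk (undual X)"

text \<open>
  The subtraction in \<^const>\<open>opp_rank\<close> never truncates, as \<open>rk\<close> is monotone.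
\<close>

lemma covers_dual_iff: "covers y x \<longleftrightarrow> covers (undual x) (undual y)"
  unfolding covers_def dual_less_iff by (metis undual_dual)

lemma rank_function_opp_rank:
  assumes "rank_function rk"
  shows "rank_function (opp_rank rk)"
proof -
  have m: "rk x \<le> rk y" if "x \<le> y" for x y
    using assms that by (auto simp: rank_function_def mono_def)
  have "opp_rank rk y = opp_rank rk x + 1" if "covers y x" for x y
  proof -
    have "rk (undual x) = rk (undual y) + 1"
      using assms that by (auto simp: rank_function_def covers_dual_iff)
    moreover have "rk (undual x) \<le> rk top" by (simp add: m)
    ultimately show ?thesis by (simp add: opp_rank_def)
  qed
  then show ?thesis
    by (auto simp: rank_function_def opp_rank_def dual_less_eq_iff intro!: monoI diff_le_mono2 m)
qed

lemma atoms_dual: "atoms = dual ` coatoms"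
proof (intro set_eqI iffI)
  fix x :: "'a dual"
  assume "x \<in> atoms"
  then have "undual x \<in> coatoms" by (simp add: atoms_def coatoms_def covers_dual_iff)
  then show "x \<in> dual ` coatoms" by (metis dual_undual imageI)
qed (auto simp: atoms_def coatoms_def covers_dual_iff)

text \<open>
  Linear orders on the atoms are reflexive relations, so \<open>a\<close> being strictly smaller than
  \<open>d\<close> is \<open>(a, d) \<in> \<omega> \<and> a \<noteq> d\<close>.
\<close>

definition bounded_below :: "'a::complete_lattice rel \<Rightarrow> 'a set \<Rightarrow> bool" where
  "bounded_below \<omega> D \<longleftrightarrow> D \<noteq> {} \<and> D \<subseteq> atoms \<and>
     (\<exists>a\<in>atoms. (\<forall>d\<in>D. (a, d) \<in> \<omega> \<and> a \<noteq> d) \<and> a \<le> Sup D)"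

definition NBB :: "'a::complete_lattice rel \<Rightarrow> 'a set \<Rightarrow> bool" where
  "NBB \<omega> I \<longleftrightarrow> I \<subseteq> atoms \<and> (\<forall>D \<subseteq> I. \<not> bounded_below \<omega> D)"

definition NBB_sets :: "'a::complete_lattice set set" where
  "NBB_sets = {I. \<exists>\<omega>. linear_order_on atoms \<omega> \<and> NBB \<omega> I}"

definition geometric :: "('a::complete_lattice \<Rightarrow> nat) \<Rightarrow> 'a set \<Rightarrow> bool" where
  "geometric rk I \<longleftrightarrow> I \<in> NBB_sets \<and> rk (Sup I) = card I"

text \<open>Maximality is among all members of \<^const>\<open>NBB_sets\<close>, not only the geometric ones.\<close>

definition bases :: "('a::complete_lattice \<Rightarrow> nat) \<Rightarrow> 'a set set" where
  "bases rk = {I \<in> NBB_sets. (\<forall>J \<in> NBB_sets. I \<subseteq> J \<longrightarrow> J = I) \<and> (\<forall>S \<subseteq> I. geometric rk S)}"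

definition opp_set :: "'a::complete_lattice set \<Rightarrow> 'a dual set" where
  "opp_set I = {dual (Sup (I - {a})) | a. a \<in> I}"

end

theory Submission
  imports Defs
begin

text \<open>
  Each element of an NBB set that is minimal for the order is not below the join of the larger
  ones, so an NBB set \<open>I\<close> satisfies \<open>card I \<le> rk (Sup I)\<close>, and by atomicity a maximal one has
  join \<^const>\<open>top\<close>. Hence the bases are exactly the sets \<open>I\<close> of \<open>rk top\<close> atoms with
  \<open>rk (Sup S) = card S\<close> for all \<open>S \<subseteq> I\<close>. For a basis \<open>I\<close> and \<open>T \<subseteq> I\<close>, the meet of the
  \<open>Sup (I - {a})\<close> with \<open>a \<in> T\<close> has rank at least \<open>rk (Sup (I - T)) = card I - card T\<close>, and at
  most this since every further \<open>a\<close> strictly lowers the meet; so it equals \<open>Sup (I - T)\<close>. This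
  shows both that \<open>opp_set I\<close> is a basis of the opposite lattice and that applying
  \<^const>\<open>opp_set\<close> twice gives back \<open>I\<close>.
\<close>

section \<open>Rank functions and linear orders\<close>

lemma rank_function_strict_mono:
  fixes x y :: "'a::{finite, complete_lattice}"
  assumes "rank_function rk" "x < y"
  shows "rk x < rk y"
proof -
  \<comment> \<open>By finiteness there is a minimal \<open>z\<close> strictly above
    \<open>x\<close> with \<open>z \<le> y\<close>. It covers \<open>x\<close>, so the rank already
    jumps there; \<open>mono\<close> does the rest.\<close>
  obtain z where z: "x < z" "z \<le> y" and min: "\<And>w. x < w \<Longrightarrow> w \<le> z \<Longrightarrow> w = z"
    using finite_has_minimal2[of "{z. x < z}" y] assms(2) by auto
  have "covers z x"
    using z min by (auto simp: covers_def order.strict_iff_order)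
  then have "rk z = rk x + 1" using assms(1) by (simp add: rank_function_def)
  moreover have "rk z \<le> rk y" using assms(1) z(2) by (auto simp: rank_function_def mono_def)
  ultimately show ?thesis by simp
qed

lemma rank_function_eq:
  fixes x y :: "'a::{finite, complete_lattice}"
  assumes "rank_function rk" "x \<le> y" "rk y \<le> rk x"
  shows "x = y"
  using rank_function_strict_mono[OF assms(1), of x y] assms(2,3) by fastforce

lemma linear_order_on_finite_min:
  assumes "finite I" "I \<noteq> {}" "I \<subseteq> A" "linear_order_on A r"
  shows "\<exists>m\<in>I. \<forall>d\<in>I. (m, d) \<in> r"
  using assms
proof (induction I rule: finite_ne_induct)
  case (singleton x)
  then show ?case by (auto simp: order_on_defs refl_on_def)
next
  case (insert x F)
  then obtain m where m: "m \<in> F" "\<forall>d\<in>F. (m, d) \<in> r" by auto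
  have tr: "trans r" and rf: "(x, x) \<in> r" and tot: "(m, x) \<in> r \<or> (x, m) \<in> r"
    using insert.prems insert.hyps m by (auto simp: order_on_defs refl_on_def total_on_def)
  from tot show ?case
  proof
    assume "(m, x) \<in> r"
    with m show ?thesis by blast
  next
    assume "(x, m) \<in> r"
    then have "\<forall>d\<in>insert x F. (x, d) \<in> r" using m rf transD[OF tr] by blast
    then show ?thesis by blast
  qed
qed

text \<open>Serves to make a newly added atom the least one, so that no bounded below set can
  contain it.\<close>

lemma linear_order_on_move_first:
  assumes "linear_order_on A r" "a \<in> A"
  shows "linear_order_on A ({a} \<times> A \<union> (r \<inter> (A - {a}) \<times> (A - {a})))"
    (is "linear_order_on A ?r")
proof -
  have r: "r \<subseteq> A \<times> A" "refl_on A r" "trans r" "antisym r" "total_on A r"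
    using assms(1) by (auto simp: order_on_defs)
  have "?r \<subseteq> A \<times> A" "refl_on A ?r" "total_on A ?r" "antisym ?r"
    using r assms(2) by (auto simp: refl_on_def total_on_def antisym_def)
  moreover have "trans ?r"
  proof (rule transI)
    fix x y z assume xy: "(x, y) \<in> ?r" and yz: "(y, z) \<in> ?r"
    show "(x, z) \<in> ?r"
    proof (cases "x = a")
      case True
      with yz assms(2) show ?thesis by auto
    next
      case False
      with xy yz transD[OF r(3), of x y z] show ?thesis by auto
    qed
  qed
  ultimately show ?thesis by (simp add: order_on_defs)
qed

section \<open>NBB sets and bases\<close>

lemma empty_in_NBB_sets: "{} \<in> NBB_sets"
  \<comment> \<open>Even the empty set needs some linear order on the atoms; a well-order supplies
    one.\<close>
  using well_order_on[of atoms] by (auto simp: NBB_sets_def NBB_def bounded_below_def well_order_on_def)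

text \<open>Move \<open>a\<close> to the front of the order. A bounded below \<open>D\<close> then
  avoids \<open>a\<close>, so \<open>D \<subseteq> I\<close>; its witness is not \<open>a\<close>,
  because \<open>a\<close> is not below \<open>Sup I\<close>; hence \<open>D\<close> was already
  bounded below for the old order.\<close>

lemma insert_in_NBB_sets:
  assumes "I \<in> NBB_sets" "a \<in> atoms" "\<not> a \<le> Sup I"
  shows "insert a I \<in> NBB_sets"
proof -
  obtain \<omega> where lin: "linear_order_on atoms \<omega>" and I: "NBB \<omega> I"
    using assms(1) by (auto simp: NBB_sets_def)
  define \<omega>' where "\<omega>' = {a} \<times> atoms \<union> (\<omega> \<inter> (atoms - {a}) \<times> (atoms - {a}))"
  have "\<not> bounded_below \<omega>' D" if D: "D \<subseteq> insert a I" for D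
  proof
    assume "bounded_below \<omega>' D"
    then obtain b where b: "D \<noteq> {}" "D \<subseteq> atoms" "b \<in> atoms"
        "\<forall>d\<in>D. (b, d) \<in> \<omega>' \<and> b \<noteq> d" "b \<le> Sup D"
      by (auto simp: bounded_below_def)
    have "a \<notin> D" using b(4) by (auto simp: \<omega>'_def)
    then have "D \<subseteq> I" using D by auto
    then have "b \<noteq> a" using assms(3) b(5) Sup_subset_mono order_trans by blast
    then have "\<forall>d\<in>D. (b, d) \<in> \<omega> \<and> b \<noteq> d" using b(4) by (auto simp: \<omega>'_def)
    then have "bounded_below \<omega> D" using b by (auto simp: bounded_below_def)
    then show False using I \<open>D \<subseteq> I\<close> by (auto simp: NBB_def)
  qed
  then have "NBB \<omega>' (insert a I)"
    using I assms(2) by (auto simp: NBB_def)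
  moreover have "linear_order_on atoms \<omega>'"
    unfolding \<omega>'_def by (rule linear_order_on_move_first) fact+
  ultimately show ?thesis by (auto simp: NBB_sets_def)
qed

text \<open>Remove the \<open>\<omega>\<close>-least element \<open>m\<close>: were it below the
  join of the others, it would witness that they are bounded below. So each removal strictly lowers
  the join, and with it the rank.\<close>

lemma NBB_card_le_rank:
  fixes rk :: "'a::{finite, complete_lattice} \<Rightarrow> nat"
  assumes "rank_function rk" "linear_order_on atoms \<omega>" "NBB \<omega> I"
  shows "card I \<le> rk (Sup I)"
  using finite[of I] assms(3)
proof (induction I rule: finite_psubset_induct)
  case (psubset I)
  show ?case
  proof (cases "I = {}")
    case False
    then obtain m where m: "m \<in> I" "\<forall>d\<in>I. (m, d) \<in> \<omega>"
      using linear_order_on_finite_min[OF finite _ _ assms(2), of I] psubset.prems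
      by (auto simp: NBB_def)
    have I: "I \<subseteq> atoms" "\<not> bounded_below \<omega> (I - {m})"
      using psubset.prems by (auto simp: NBB_def)
    have "\<not> m \<le> Sup (I - {m})"
    \<comment> \<open>\<open>bounded_below\<close> speaks of nonempty sets only, so a singleton
      \<open>I\<close> is treated apart: an atom is not below \<open>bot\<close>.\<close>
    proof (cases "I - {m} = {}")
      case True
      have "m \<noteq> bot" using I m by (auto simp: atoms_def covers_def)
      then show ?thesis unfolding True by (simp add: bot_unique)
    next
      case False
      then show ?thesis using I m unfolding bounded_below_def by blast
    qed
    then have "Sup (I - {m}) < Sup I"
      by (metis Diff_subset Sup_subset_mono Sup_upper m(1) order.not_eq_order_implies_strict)
    then have "rk (Sup (I - {m})) < rk (Sup I)"
      by (rule rank_function_strict_mono[OF assms(1)])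
    moreover have "card (I - {m}) \<le> rk (Sup (I - {m}))"
      using psubset.prems m(1) by (intro psubset.IH) (auto simp: NBB_def)
    ultimately show ?thesis using m card_Suc_Diff1[of I m] by simp
  qed simp
qed

lemma NBB_sets_card_le_rank:
  fixes rk :: "'a::{finite, complete_lattice} \<Rightarrow> nat"
  assumes "rank_function rk" "I \<in> NBB_sets"
  shows "card I \<le> rk (Sup I)"
  using assms NBB_card_le_rank by (auto simp: NBB_sets_def)

text \<open>Build the set one atom at a time: each new atom raises the rank of the join, so it is
  not below the previous join and may be inserted.\<close>

lemma rank_eq_card_imp_NBB_sets:
  fixes rk :: "'a::{finite, complete_lattice} \<Rightarrow> nat"
  assumes "I \<subseteq> atoms" "\<And>S. S \<subseteq> I \<Longrightarrow> rk (Sup S) = card S"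
  shows "I \<in> NBB_sets"
  using finite[of I] assms
proof (induction I rule: finite_induct)
  case (insert a I)
  have "rk (Sup I) = card I" "rk (Sup (insert a I)) = card (insert a I)"
    using insert.prems(2) by blast+
  then have "Sup (insert a I) \<noteq> Sup I" using insert.hyps by auto
  then have "\<not> a \<le> Sup I" by (auto simp: sup_absorb2)
  then show ?case using insert by (intro insert_in_NBB_sets) auto
qed (simp add: empty_in_NBB_sets)

text \<open>Eliminates linear orders and maximality, leaving conditions on ranks of joins that can
  be compared across the two lattices. Conversely, maximality follows because no NBB set has more
  than \<open>rk top\<close> elements.\<close>

lemma bases_iff:
  fixes rk :: "'a::{finite, complete_lattice} \<Rightarrow> nat"
  assumes rk: "rank_function rk" and at: "atomic_lattice TYPE('a)"
  shows "I \<in> bases rk \<longleftrightarrow> I \<subseteq> atoms \<and> card I = rk top \<and> (\<forall>S\<subseteq>I. rk (Sup S) = card S)"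
    (is "_ \<longleftrightarrow> ?R")
proof
  assume I: "I \<in> bases rk"
  then have NBB: "I \<in> NBB_sets" and mx: "\<And>J. J \<in> NBB_sets \<Longrightarrow> I \<subseteq> J \<Longrightarrow> J = I"
    and g: "\<forall>S\<subseteq>I. rk (Sup S) = card S"
    by (auto simp: bases_def geometric_def)
  have "a \<le> Sup I" if "a \<in> atoms" for a
  proof (rule ccontr)
    assume "\<not> a \<le> Sup I"
    then have "insert a I = I" using mx insert_in_NBB_sets[OF NBB that] by blast
    with \<open>\<not> a \<le> Sup I\<close> show False by (metis Sup_upper insertI1)
  qed
  moreover obtain A where "A \<subseteq> atoms" "(top::'a) = Sup A"
    using at by (auto simp: atomic_lattice_def)
  ultimately have "Sup I = top" by (metis Sup_least subset_eq top_unique)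
  then show ?R using NBB g by (force simp: NBB_sets_def NBB_def)
next
  assume R: ?R
  have NBB: "S \<in> NBB_sets" if "S \<subseteq> I" for S
    using R that by (intro rank_eq_card_imp_NBB_sets[of S rk]) auto
  have "J = I" if "J \<in> NBB_sets" "I \<subseteq> J" for J
  proof -
    have "card J \<le> rk (Sup J)" by (rule NBB_sets_card_le_rank) fact+
    also have "\<dots> \<le> card I" using R rk by (auto simp: rank_function_def mono_def)
    finally show ?thesis using that(2) card_seteq[of J I] by simp
  qed
  then show "I \<in> bases rk" using R NBB by (auto simp: bases_def geometric_def)
qed

section \<open>Meets of the coatoms attached to a basis\<close>

lemma Inf_opp_set:
  fixes rk :: "'a::{finite, complete_lattice} \<Rightarrow> nat"
  assumes rk: "rank_function rk" and top: "card I = rk top"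
    and g: "\<And>S. S \<subseteq> I \<Longrightarrow> rk (Sup S) = card S" and T: "T \<subseteq> I"
  shows "Inf ((\<lambda>a. Sup (I - {a})) ` T) = Sup (I - T)"
proof -
  let ?c = "\<lambda>a. Sup (I - {a})"
  \<comment> \<open>The additive form avoids truncated subtraction. For empty \<open>T\<close> the
    meet is \<open>top\<close>.\<close>
  have "rk (Inf (?c ` T)) + card T \<le> rk top"
    using finite[of T] T
  proof (induction T rule: finite_induct)
    case (insert b T)
    \<comment> \<open>The element \<open>b\<close> separates the two meets: it lies below
      \<open>?c a\<close> for every \<open>a\<close> in \<open>T\<close>, as
      \<open>b \<noteq> a\<close>, but not below \<open>?c b\<close>.\<close>
    have "b \<le> Inf (?c ` T)"
      using insert by (auto intro!: INF_greatest Sup_upper)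
    moreover have "\<not> b \<le> ?c b"
    proof
      assume "b \<le> ?c b"
      then have "Sup I = ?c b"
        using insert.prems Sup_insert[of b "I - {b}"] by (simp add: insert_absorb sup_absorb2)
      then have "card I = card (I - {b})" using g[of I] g[of "I - {b}"] by simp
      then show False using insert.prems by (metis card_Diff1_less finite insert_subset less_irrefl)
    qed
    moreover have "Inf (?c ` insert b T) \<le> ?c b" "Inf (?c ` insert b T) \<le> Inf (?c ` T)"
      by (auto intro: INF_lower Inf_superset_mono)
    ultimately have "Inf (?c ` insert b T) < Inf (?c ` T)"
      unfolding less_le_not_le by (blast intro: order_trans)
    then have "rk (Inf (?c ` insert b T)) < rk (Inf (?c ` T))"
      by (rule rank_function_strict_mono[OF rk])
    moreover have "rk (Inf (?c ` T)) + card T \<le> rk top"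
      using insert by simp
    ultimately show ?case using insert.hyps by simp
  qed simp
  moreover have "rk (Sup (I - T)) + card T = rk top"
    using g[of "I - T"] top T card_mono[of I T] by (simp add: card_Diff_subset)
  moreover have "Sup (I - T) \<le> Inf (?c ` T)"
    by (auto intro!: INF_greatest Sup_subset_mono)
  ultimately show ?thesis using rank_function_eq[OF rk, of "Sup (I - T)" "Inf (?c ` T)"] by simp
qed

section \<open>Passage to the opposite lattice\<close>

lemma opp_set_eq: "opp_set I = (\<lambda>a. dual (Sup (I - {a}))) ` I"
  by (auto simp: opp_set_def)

lemma atomic_lattice_dual:
  assumes "coatomic_lattice TYPE('a::complete_lattice)"
  shows "atomic_lattice TYPE('a dual)"
  unfolding atomic_lattice_def
proof
  fix x :: "'a dual"
  obtain C where "C \<subseteq> coatoms" "undual x = Inf C"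
    using assms by (auto simp: coatomic_lattice_def)
  then have "dual ` C \<subseteq> atoms" "x = Sup (dual ` C)"
    by (auto simp: atoms_dual dual_eq_iff image_image)
  then show "\<exists>A\<subseteq>atoms. x = Sup A" by blast
qed

lemma coatoms_dual: "coatoms = dual ` atoms"
proof (intro set_eqI iffI)
  fix x :: "'a dual"
  assume "x \<in> coatoms"
  then have "undual x \<in> atoms" by (simp add: atoms_def coatoms_def covers_dual_iff)
  then show "x \<in> dual ` atoms" by (metis dual_undual imageI)
qed (auto simp: atoms_def coatoms_def covers_dual_iff)

text \<open>With this, all hypotheses also hold for \<open>'a dual\<close>, so that the results can
  be applied there again.\<close>

lemma coatomic_lattice_dual:
  assumes "atomic_lattice TYPE('a::complete_lattice)"
  shows "coatomic_lattice TYPE('a dual)"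
  unfolding coatomic_lattice_def
proof
  fix x :: "'a dual"
  obtain C where "C \<subseteq> atoms" "undual x = Sup C"
    using assms by (auto simp: atomic_lattice_def)
  then have "dual ` C \<subseteq> coatoms" "x = Inf (dual ` C)"
    by (auto simp: coatoms_dual dual_eq_iff image_image)
  then show "\<exists>A\<subseteq>coatoms. x = Inf A" by blast
qed

text \<open>For \<open>a \<noteq> b\<close> the sets \<open>I - {a}\<close> and
  \<open>I - {b}\<close> together cover \<open>I\<close>; if their joins agreed, each would equal
  \<open>Sup I\<close>, whose rank is larger.\<close>

lemma inj_on_Sup_remove:
  fixes rk :: "'a::{finite, complete_lattice} \<Rightarrow> nat"
  assumes g: "\<And>S. S \<subseteq> I \<Longrightarrow> rk (Sup S) = card S"
  shows "inj_on (\<lambda>a. Sup (I - {a})) I"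
proof (rule inj_onI, rule ccontr)
  fix a b assume ab: "a \<in> I" "b \<in> I" "Sup (I - {a}) = Sup (I - {b})" "a \<noteq> b"
  have "Sup I = sup (Sup (I - {a})) (Sup (I - {b}))"
    using ab by (subst Sup_union_distrib[symmetric]) (auto intro: arg_cong[of _ _ Sup])
  then have "card I = card (I - {a})" using g[of I] g[of "I - {a}"] ab by simp
  then show False using ab by (metis card_Diff1_less finite less_irrefl)
qed

lemma opp_set_in_bases:
  fixes rk :: "'a::{finite, complete_lattice} \<Rightarrow> nat"
  assumes rk: "rank_function rk" and at: "atomic_lattice TYPE('a)"
    and co: "coatomic_lattice TYPE('a)" and I: "I \<in> bases rk"
  shows "opp_set I \<in> bases (opp_rank rk)"
proof -
  let ?c = "\<lambda>a. Sup (I - {a})"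
  have top: "card I = rk top" and g: "\<And>S. S \<subseteq> I \<Longrightarrow> rk (Sup S) = card S"
    using I bases_iff[OF rk at] by auto
  have inj: "inj_on ?c I" using g by (rule inj_on_Sup_remove)
  then have card: "card ((\<lambda>a. dual (?c a)) ` T) = card T" if "T \<subseteq> I" for T
    using that by (intro card_image) (auto simp: inj_on_def subset_iff simp del: dual_Sup_eq)
  have c: "rk (?c a) + 1 = rk top" if "a \<in> I" for a
    using g[of "I - {a}"] top that by (metis Diff_subset Suc_eq_plus1 card_Suc_Diff1 finite)
  have "?c a \<in> coatoms" if "a \<in> I" for a
  proof -
    have "?c a \<noteq> top" using c[OF that] by auto
    \<comment> \<open>Ranks strictly increase, and there is no room between
      \<open>rk top - 1\<close> and \<open>rk top\<close>.\<close>
    moreover have False if "?c a < z" "z < top" for z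
      using c[OF \<open>a \<in> I\<close>] that[THEN rank_function_strict_mono[OF rk]] by simp
    ultimately show ?thesis by (auto simp: coatoms_def covers_def less_top)
  qed
  then have "opp_set I \<subseteq> atoms" by (auto simp: opp_set_eq atoms_dual simp del: dual_Sup_eq)
  moreover have "card (opp_set I) = opp_rank rk top"
    using card[of I] top rk by (simp add: opp_set_eq opp_rank_def rank_function_def)
  moreover have "opp_rank rk (Sup S) = card S" if S: "S \<subseteq> opp_set I" for S
  proof -
    obtain T where T: "T \<subseteq> I" "S = (\<lambda>a. dual (?c a)) ` T"
      using S by (auto simp: opp_set_eq subset_image_iff)
    \<comment> \<open>Joins in \<open>'a dual\<close> are meets in \<open>'a\<close>, which turns
      the rank condition into a statement about \<open>Sup (I - T)\<close>.\<close>
    have "undual (Sup S) = Inf (?c ` T)" by (simp add: T(2) image_image)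
    also have "\<dots> = Sup (I - T)" by (rule Inf_opp_set[OF rk top g T(1)])
    finally have "opp_rank rk (Sup S) = card I - card (I - T)"
      using g[of "I - T"] top by (simp add: opp_rank_def)
    also have "\<dots> = card T"
      using T(1) card_mono[of I T] by (simp add: card_Diff_subset)
    finally show ?thesis using card[OF T(1)] T(2) by simp
  qed
  ultimately show ?thesis
    using bases_iff[OF rank_function_opp_rank[OF rk] atomic_lattice_dual[OF co]] by simp
qed

lemma opp_set_opp_set:
  fixes rk :: "'a::{finite, complete_lattice} \<Rightarrow> nat"
  assumes rk: "rank_function rk" and at: "atomic_lattice TYPE('a)" and I: "I \<in> bases rk"
  shows "opp_set (opp_set I) = (\<lambda>a. dual (dual a)) ` I"
proof -
  let ?c = "\<lambda>a. Sup (I - {a})"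
  have top: "card I = rk top" and g: "\<And>S. S \<subseteq> I \<Longrightarrow> rk (Sup S) = card S"
    using I bases_iff[OF rk at] by auto
  have inj: "inj_on ?c I" using g by (rule inj_on_Sup_remove)
  have "Sup (opp_set I - {dual (?c a)}) = dual a" if a: "a \<in> I" for a
  proof -
    \<comment> \<open>Only the coatoms \<open>?c b\<close> with \<open>b \<noteq> a\<close> remain,
      by injectivity; their meet is the join of the complement of \<open>I - {a}\<close> in
      \<open>I\<close>, namely of \<open>{a}\<close>.\<close>
    have "opp_set I - {dual (?c a)} = (\<lambda>a. dual (?c a)) ` (I - {a})"
      using inj a by (auto simp: opp_set_eq inj_on_def simp del: dual_Sup_eq)
    then have "Sup (opp_set I - {dual (?c a)}) = dual (Inf (?c ` (I - {a})))"
      by (simp add: dual_eq_iff image_image)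
    also have "Inf (?c ` (I - {a})) = Sup (I - (I - {a}))"
      by (rule Inf_opp_set[OF rk top g]) auto
    also have "I - (I - {a}) = {a}" using a by auto
    finally show ?thesis by simp
  qed
  moreover have "opp_set (opp_set I) = (\<lambda>a. dual (Sup (opp_set I - {dual (?c a)}))) ` I"
    unfolding opp_set_eq[of "opp_set I"] by (subst (2) opp_set_eq) (simp only: image_image)
  ultimately show ?thesis by (simp cong: image_cong del: dual_Sup_eq)
qed

section \<open>Bijectivity\<close>

lemma inj_on_opp_set_bases:
  fixes rk :: "'a::{finite, complete_lattice} \<Rightarrow> nat"
  assumes "rank_function rk" "atomic_lattice TYPE('a)"
  shows "inj_on opp_set (bases rk)"
proof (rule inj_onI)
  fix I J assume IJ: "I \<in> bases rk" "J \<in> bases rk" "opp_set I = opp_set J"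
  then have "(\<lambda>a. dual (dual a)) ` I = (\<lambda>a. dual (dual a)) ` J"
    using opp_set_opp_set[OF assms] by metis
  then show "I = J" by (subst (asm) inj_image_eq_iff) (auto simp: inj_def)
qed

text \<open>The double opposite is only a copy of \<open>'a\<close>, a different type; this carries
  its bases back to \<open>'a\<close>.\<close>

lemma undual_undual_image_in_bases:
  fixes rk :: "'a::{finite, complete_lattice} \<Rightarrow> nat"
  assumes rk: "rank_function rk" and at: "atomic_lattice TYPE('a)"
    and K: "K \<in> bases (opp_rank (opp_rank rk))"
  shows "(\<lambda>x. undual (undual x)) ` K \<in> bases rk"
proof -
  let ?u = "\<lambda>x::'a dual dual. undual (undual x)"
  \<comment> \<open>The top of \<open>'a dual\<close> comes from \<open>bot\<close>, of rank 0, so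
    the double opposite rank is \<open>rk top - (rk top - rk (?u x))\<close>, without
    truncation.\<close>
  have rr: "opp_rank (opp_rank rk) x = rk (?u x)" for x
  proof -
    have "rk (?u x) \<le> rk top" using rk by (auto simp: rank_function_def mono_def)
    then show ?thesis using rk by (simp add: opp_rank_def rank_function_def)
  qed
  have "rank_function (opp_rank (opp_rank rk))" "atomic_lattice TYPE('a dual dual)"
    by (intro rank_function_opp_rank rk atomic_lattice_dual coatomic_lattice_dual at)+
  from K[unfolded bases_iff[OF this] rr]
  have K: "K \<subseteq> atoms" "card K = rk top" "\<And>S. S \<subseteq> K \<Longrightarrow> rk (?u (Sup S)) = card S"
    by auto
  have card: "card (?u ` S) = card S" for S
    by (intro card_image) (auto simp: inj_on_def dual_eq_iff)
  have "rk (Sup T) = card T" if "T \<subseteq> ?u ` K" for T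
  proof -
    obtain S where "S \<subseteq> K" "T = ?u ` S" using \<open>T \<subseteq> ?u ` K\<close> by (rule subset_imageE)
    moreover from this have "?u (Sup S) = Sup T" by (simp add: image_image)
    ultimately show ?thesis using K(3)[of S] card[of S] by simp
  qed
  moreover have "?u ` K \<subseteq> atoms" using K(1) by (auto simp: atoms_dual coatoms_dual)
  ultimately show ?thesis using K(2) card[of K] by (simp add: bases_iff[OF rk at])
qed

theorem theorem4p5:
  fixes rk :: "'a::{finite, complete_lattice} \<Rightarrow> nat"
  assumes "rank_function rk"
    and "atomic_lattice TYPE('a)"
    and "coatomic_lattice TYPE('a)"
  shows "bij_betw opp_set (bases rk) (bases (opp_rank rk))"
proof -
  have rk': "rank_function (opp_rank rk)" and at': "atomic_lattice TYPE('a dual)"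
    and co': "coatomic_lattice TYPE('a dual)"
    using assms rank_function_opp_rank atomic_lattice_dual coatomic_lattice_dual by auto
  \<comment> \<open>The candidate map backwards: \<open>opp_set\<close> on the opposite lattice,
    followed by identifying the double opposite with \<open>'a\<close>.\<close>
  let ?h = "\<lambda>J :: 'a dual set. (\<lambda>x. undual (undual x)) ` opp_set J"
  have "inj (\<lambda>x :: 'a dual dual. undual (undual x))"
    by (auto simp: inj_def dual_eq_iff)
  then have "inj_on ?h (bases (opp_rank rk))"
    using inj_on_opp_set_bases[OF rk' at'] by (auto simp: inj_on_def inj_image_eq_iff)
  moreover have "?h ` bases (opp_rank rk) \<subseteq> bases rk"
    using undual_undual_image_in_bases[OF assms(1,2)] opp_set_in_bases[OF rk' at' co'] by blast
  \<comment> \<open>Both families are finite, so injectivity of \<open>?h\<close> gives the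
    cardinality bound that makes the injective \<open>opp_set\<close> surjective; it need not be
    shown that \<open>?h\<close> inverts it.\<close>
  ultimately have "card (bases (opp_rank rk)) \<le> card (bases rk)"
    by (rule card_inj_on_le) simp
  moreover have inj: "inj_on opp_set (bases rk)"
    using assms(1,2) by (rule inj_on_opp_set_bases)
  moreover have "opp_set ` bases rk \<subseteq> bases (opp_rank rk)"
    using opp_set_in_bases[OF assms] by blast
  ultimately have "opp_set ` bases rk = bases (opp_rank rk)"
    by (intro card_seteq) (auto simp: card_image)
  with inj show ?thesis by (simp add: bij_betw_def)
qed

end
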